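(* Let $\mathcal I$ be a nominal model of the simply-typed $\lambda$-calculus (as defined in the context). If $\Gamma\vdash r:\phi$ is a derivable typing judgement, then $[\![r]\!]_\Gamma\in\mathcal I_\Gamma(\phi)$. Moreover, if $\Gamma\vdash r:\phi$ then $\mathrm{supp}([\![r]\!]_\Gamma)\subseteq\mathrm{fa}(r)$.
   Context: Atoms and nominal sets: fix a countably infinite set $\mathbb A$ of atoms. A permutation is a bijection $\pi$ of $\mathbb A$ with $\{a\mid \pi(a)\neq a\}$ finite. We work in set theory with atoms (ZFA), with permutation action $\pi\cdot a=\pi(a)$ for atoms and $\pi\cdot X=\{\pi\cdot x\mid x\in X\}$ for sets. A set $A\subseteq\mathbb A$ supports $x$ if $\pi\cdot x=x$ for every permutation $\pi$ fixing $A$ pointwise; if $x$ has a finite supporting set it has a least one, $\mathrm{supp}(x)$ ($x$ is finitely supported); $a\# x$ means $a\notin\mathrm{supp}(x)$. Syntax: types $\phi::=\tau\mid\phi\to\phi$ over a nonempty set of base types $\tau$; a set of constants $C$, each with a type $\mathrm{type}(C)$; terms $r::=a\mid C\mid \lambda a{:}\phi.r\mid rr$ (with $a\in\mathbb A$), taken up to $\alpha$-equivalence; $\mathrm{fa}(r)$ is the set of free atoms of $r$. A type environment $\Gamma$ is a set of typings $a{:}\phi$ that is functional (each atom gets at most one type); $\mathrm{dom}(\Gamma)$ is the set of atoms typed in it; writing $\Gamma,a{:}\phi$ presupposes $a\notin\mathrm{dom}(\Gamma)$; $\pi\cdot\Gamma=\{\pi(a){:}\phi\mid a{:}\phi\in\Gamma\}$.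 Typing rules: $\Gamma,a{:}\phi\vdash a:\phi$; $\Gamma\vdash C:\mathrm{type}(C)$; from $\Gamma,a{:}\phi\vdash r:\psi$ (with $a\notin\mathrm{dom}(\Gamma)$) infer $\Gamma\vdash\lambda a{:}\phi.r:\phi\to\psi$; from $\Gamma\vdash r:\phi\to\psi$ and $\Gamma\vdash s:\phi$ infer $\Gamma\vdash rs:\psi$. Model: a model $\mathcal I$ assigns to each type environment $\Gamma$ and type $\phi$ a finitely-supported set $\mathcal I_\Gamma(\phi)$, together with: (1) for each $a{:}\phi\in\Gamma$ an element $a^{\mathcal I}_\phi\in\mathcal I_\Gamma(\phi)$; (2) for each constant $C$ an element $C^{\mathcal I}\in\mathcal I_\Gamma(\mathrm{type}(C))$; (3) for each $x\in\mathcal I_{\Gamma,a:\phi}(\psi)$ an element $[a{:}\phi]x\in\mathcal I_\Gamma(\phi\to\psi)$; (4) for $x\in\mathcal I_\Gamma(\phi\to\psi)$ and $y\in\mathcal I_\Gamma(\phi)$ an element $x\bullet y\in\mathcal I_\Gamma(\psi)$; such that (5) $\mathcal I_{\Gamma\cap\Gamma'}(\phi)=\mathcal I_\Gamma(\phi)\cap\mathcal I_{\Gamma'}(\phi)$; (6) if $x\in\mathcal I_\Gamma(\phi)$ then $\mathrm{supp}(x)\subseteq\mathrm{dom}(\Gamma)$. It must be equivariant: $\{\pi\cdot x\mid x\in\mathcal I_\Gamma(\phi)\}=\mathcal I_{\pi\cdot\Gamma}(\phi)$, $\pi\cdot a^{\mathcal I}_\phi=(\pi(a))^{\mathcal I}_\phi$,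 $\pi\cdot C^{\mathcal I}=C^{\mathcal I}$, $\pi\cdot[a{:}\phi]x=[\pi(a){:}\phi](\pi\cdot x)$, $\pi\cdot(x\bullet y)=(\pi\cdot x)\bullet(\pi\cdot y)$. Writing $x[a\mapsto y]$ for $([a{:}\phi]x)\bullet y$ (types filled in appropriately), it must satisfy: $a^{\mathcal I}_\phi[a\mapsto x]=x$; if $a\# z$ then $z[a\mapsto x]=z$; $(z'\bullet z)[a\mapsto x]=(z'[a\mapsto x])\bullet(z[a\mapsto x])$; if $c\# x$ then $([c{:}\chi]z)[a\mapsto x]=[c{:}\chi](z[a\mapsto x])$. Interpretation: for $\Gamma\vdash r:\phi$, define $[\![r]\!]_\Gamma$ inductively: $[\![a]\!]_{\Gamma}=a^{\mathcal I}_\phi$ when $a{:}\phi\in\Gamma$; $[\![C]\!]_\Gamma=C^{\mathcal I}$; $[\![rs]\!]_\Gamma=[\![r]\!]_\Gamma\bullet[\![s]\!]_\Gamma$; $[\![\lambda a{:}\phi.r]\!]_\Gamma=[a{:}\phi][\![r]\!]_{\Gamma,a:\phi}$. *)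

theory Defs
  imports "HOL-Combinatorics.Perm"
begin

unbundle permutation_syntax

section \<open>Atoms, permutations and support\<close>

datatype atom = Atom nat

text \<open>
  The library type \<^typ>\<open>atom perm\<close> consists of the bijections of \<^typ>\<open>atom\<close> that move only
  finitely many atoms. Instead of the ZFA universe we work with an arbitrary type on which these
  permutations act. Sets of elements are acted on pointwise.
\<close>

locale perm_action =
  fixes act :: "atom perm \<Rightarrow> 'u \<Rightarrow> 'u"
  assumes act_one: "act 1 x = x"
    and act_times: "act (p * q) x = act p (act q x)"

definition supports :: "(atom perm \<Rightarrow> 'x \<Rightarrow> 'x) \<Rightarrow> atom set \<Rightarrow> 'x \<Rightarrow> bool" where
  "supports act A x \<longleftrightarrow> (\<forall>p. (\<forall>a\<in>A. p \<langle>$\<rangle> a = a) \<longrightarrow> act p x = x)"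

definition finitely_supported :: "(atom perm \<Rightarrow> 'x \<Rightarrow> 'x) \<Rightarrow> 'x \<Rightarrow> bool" where
  "finitely_supported act x \<longleftrightarrow> (\<exists>A. finite A \<and> supports act A x)"

text \<open>
  The least finite supporting set, with respect to inclusion. The value is meaningful only for
  finitely supported \<open>x\<close>.
\<close>

definition supp :: "(atom perm \<Rightarrow> 'x \<Rightarrow> 'x) \<Rightarrow> 'x \<Rightarrow> atom set" where
  "supp act x = (LEAST A. finite A \<and> supports act A x)"

definition fresh :: "(atom perm \<Rightarrow> 'x \<Rightarrow> 'x) \<Rightarrow> atom \<Rightarrow> 'x \<Rightarrow> bool" where
  "fresh act a x \<longleftrightarrow> a \<notin> supp act x"

abbreviation act_set :: "(atom perm \<Rightarrow> 'x \<Rightarrow> 'x) \<Rightarrow> atom perm \<Rightarrow> 'x set \<Rightarrow> 'x set" where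
  "act_set act p X \<equiv> act p ` X"


section \<open>Types and terms up to alpha-equivalence\<close>

datatype 'b ty = Base 'b | Fun "'b ty" "'b ty"  (infixr \<open>\<rightarrow>\<^sub>t\<close> 65)

datatype ('b, 'c) raw =
    RVar atom
  | RCon 'c
  | RLam atom "'b ty" "('b, 'c) raw"
  | RApp "('b, 'c) raw" "('b, 'c) raw"

primrec raw_perm :: "atom perm \<Rightarrow> ('b, 'c) raw \<Rightarrow> ('b, 'c) raw" where
  "raw_perm p (RVar a) = RVar (p \<langle>$\<rangle> a)"
| "raw_perm p (RCon c) = RCon c"
| "raw_perm p (RLam a \<phi> r) = RLam (p \<langle>$\<rangle> a) \<phi> (raw_perm p r)"
| "raw_perm p (RApp r s) = RApp (raw_perm p r) (raw_perm p s)"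

primrec raw_fa :: "('b, 'c) raw \<Rightarrow> atom set" where
  "raw_fa (RVar a) = {a}"
| "raw_fa (RCon c) = {}"
| "raw_fa (RLam a \<phi> r) = raw_fa r - {a}"
| "raw_fa (RApp r s) = raw_fa r \<union> raw_fa s"

text \<open>
  Renaming the binder \<open>a\<close> to \<open>b\<close> swaps all occurrences of the two atoms in the body, bound ones
  included, so that no free atom can be captured.
\<close>

inductive alpha :: "('b, 'c) raw \<Rightarrow> ('b, 'c) raw \<Rightarrow> bool" where
  alpha_refl: "alpha r r"
| alpha_sym: "alpha r s \<Longrightarrow> alpha s r"
| alpha_trans: "alpha r s \<Longrightarrow> alpha s t \<Longrightarrow> alpha r t"
| alpha_lam: "alpha r s \<Longrightarrow> alpha (RLam a \<phi> r) (RLam a \<phi> s)"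
| alpha_app: "alpha r r' \<Longrightarrow> alpha s s' \<Longrightarrow> alpha (RApp r s) (RApp r' s')"
| alpha_rename: "b \<notin> raw_fa r \<Longrightarrow> alpha (RLam a \<phi> r) (RLam b \<phi> (raw_perm \<langle>a \<leftrightarrow> b\<rangle> r))"

lemma equivp_alpha: "equivp alpha"
  by (rule equivpI) (auto simp: reflp_def symp_def transp_def
      intro: alpha_refl alpha_sym alpha_trans)

lemma raw_fa_perm: "raw_fa (raw_perm p r) = apply p ` raw_fa r"
  by (induction r) (auto simp: image_Un image_set_diff[OF bij_is_inj[OF bij_apply]])

lemma alpha_raw_fa: "alpha r s \<Longrightarrow> raw_fa r = raw_fa s"
proof (induction rule: alpha.induct)
  case (alpha_rename b r a \<phi>)
  have "x \<in> raw_fa (raw_perm \<langle>a \<leftrightarrow> b\<rangle> r) - {b} \<longleftrightarrow> x \<in> raw_fa r - {a}" for x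
  proof -
    have "x \<in> raw_fa (raw_perm \<langle>a \<leftrightarrow> b\<rangle> r) \<longleftrightarrow> \<langle>a \<leftrightarrow> b\<rangle> \<langle>$\<rangle> x \<in> raw_fa r"
      unfolding raw_fa_perm by (metis apply_sequence apply_one comp_apply id_apply image_iff swap_self)
    then show ?thesis
      using alpha_rename by (cases "x = a"; cases "x = b") auto
  qed
  then show ?case by auto
qed auto

quotient_type ('b, 'c) trm = "('b, 'c) raw" / alpha
  by (rule equivp_alpha)

lift_definition Var :: "atom \<Rightarrow> ('b, 'c) trm" is RVar .

lift_definition Con :: "'c \<Rightarrow> ('b, 'c) trm" is RCon .

lift_definition Lam :: "atom \<Rightarrow> 'b ty \<Rightarrow> ('b, 'c) trm \<Rightarrow> ('b, 'c) trm" is RLam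
  by (rule alpha_lam)

lift_definition App :: "('b, 'c) trm \<Rightarrow> ('b, 'c) trm \<Rightarrow> ('b, 'c) trm" is RApp
  by (rule alpha_app)

lift_definition fa :: "('b, 'c) trm \<Rightarrow> atom set" is raw_fa
  by (rule alpha_raw_fa)


section \<open>Typing\<close>

text \<open>
  A type environment is a set of typings that is functional, i.e. \<^const>\<open>single_valued\<close>, and
  its domain is \<^const>\<open>Domain\<close>. The environment written \<open>\<Gamma>, a:\<phi>\<close> is
  \<open>insert (a, \<phi>) \<Gamma>\<close> together with \<open>a \<notin> Domain \<Gamma>\<close>. Environments may be infinite.

  The set of constants is the domain of the partial map \<open>ctyp\<close>, which may be empty.
\<close>

type_synonym 'b env = "(atom \<times> 'b ty) set"

definition act_env :: "atom perm \<Rightarrow> 'b env \<Rightarrow> 'b env" where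
  "act_env p \<Gamma> = (\<lambda>(a, \<phi>). (p \<langle>$\<rangle> a, \<phi>)) ` \<Gamma>"

inductive typing :: "('c \<rightharpoonup> 'b ty) \<Rightarrow> 'b env \<Rightarrow> ('b, 'c) trm \<Rightarrow> 'b ty \<Rightarrow> bool"
  for ctyp :: "'c \<rightharpoonup> 'b ty" where
  typing_var: "single_valued \<Gamma> \<Longrightarrow> a \<notin> Domain \<Gamma> \<Longrightarrow> typing ctyp (insert (a, \<phi>) \<Gamma>) (Var a) \<phi>"
| typing_con: "single_valued \<Gamma> \<Longrightarrow> ctyp c = Some \<phi> \<Longrightarrow> typing ctyp \<Gamma> (Con c) \<phi>"
| typing_lam: "a \<notin> Domain \<Gamma> \<Longrightarrow> typing ctyp (insert (a, \<phi>) \<Gamma>) r \<psi> \<Longrightarrow>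
    typing ctyp \<Gamma> (Lam a \<phi> r) (\<phi> \<rightarrow>\<^sub>t \<psi>)"
| typing_app: "typing ctyp \<Gamma> r (\<phi> \<rightarrow>\<^sub>t \<psi>) \<Longrightarrow> typing ctyp \<Gamma> s \<phi> \<Longrightarrow> typing ctyp \<Gamma> (App r s) \<psi>"


section \<open>Models\<close>

text \<open>
  \<open>var a \<phi>\<close>, \<open>con c\<close>, \<open>lam a \<phi> x\<close> and \<open>app x y\<close> stand for \<open>a\<^sup>I\<^sub>\<phi>\<close>, \<open>C\<^sup>I\<close>, \<open>[a:\<phi>]x\<close> and
  \<open>x \<bullet> y\<close>. They are total functions, but every condition on them is restricted to arguments of
  the appropriate types. Hence \<open>x[a \<mapsto> y]\<close> is \<open>app (lam a \<phi> x) y\<close>.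

  In the substitution conditions \<open>z\<close> lives over \<open>\<Gamma>, a:\<phi>\<close>, while \<open>x\<close> may live over any
  environment that extends \<open>\<Gamma>\<close>, possibly one that again mentions \<open>a\<close>. This is
  exactly when \<open>lam a \<phi> z\<close> and \<open>x\<close> can be applied to each other over the larger environment.

  In \<open>dom_fs\<close> the environment has to be finitely supported itself. Without that
  restriction all models would be trivial: let \<open>\<Gamma>\<close> type infinitely many atoms with \<open>\<phi>\<close>, leave
  infinitely many untyped, and suppose that a finite set supports \<open>I \<Gamma> \<phi>\<close>. By \<open>dom_eqvt\<close>,
  \<open>var b \<phi> \<in> I \<Gamma> \<phi>\<close> for some \<open>b\<close> outside \<open>Domain \<Gamma>\<close>, so \<open>b\<close> is fresh for
  \<open>var b \<phi>\<close>, and \<open>subst_var\<close> and \<open>subst_fresh\<close> yield \<open>x = var b \<phi>\<close> for every \<open>x\<close> of type \<open>\<phi>\<close>.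
\<close>

locale nominal_model = perm_action act
  for act :: "atom perm \<Rightarrow> 'u \<Rightarrow> 'u" +
  fixes ctyp :: "'c \<rightharpoonup> 'b ty"
    and I :: "'b env \<Rightarrow> 'b ty \<Rightarrow> 'u set"
    and var :: "atom \<Rightarrow> 'b ty \<Rightarrow> 'u"
    and con :: "'c \<Rightarrow> 'u"
    and lam :: "atom \<Rightarrow> 'b ty \<Rightarrow> 'u \<Rightarrow> 'u"
    and app :: "'u \<Rightarrow> 'u \<Rightarrow> 'u"
  assumes dom_fs:
      "single_valued \<Gamma> \<Longrightarrow> finitely_supported act_env \<Gamma> \<Longrightarrow>
        finitely_supported (act_set act) (I \<Gamma> \<phi>)"
    and var_mem: "single_valued \<Gamma> \<Longrightarrow> (a, \<phi>) \<in> \<Gamma> \<Longrightarrow> var a \<phi> \<in> I \<Gamma> \<phi>"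
    and con_mem: "single_valued \<Gamma> \<Longrightarrow> ctyp k = Some \<phi> \<Longrightarrow> con k \<in> I \<Gamma> \<phi>"
    and lam_mem:
      "single_valued \<Gamma> \<Longrightarrow> a \<notin> Domain \<Gamma> \<Longrightarrow> x \<in> I (insert (a, \<phi>) \<Gamma>) \<psi> \<Longrightarrow>
        lam a \<phi> x \<in> I \<Gamma> (\<phi> \<rightarrow>\<^sub>t \<psi>)"
    and app_mem:
      "single_valued \<Gamma> \<Longrightarrow> x \<in> I \<Gamma> (\<phi> \<rightarrow>\<^sub>t \<psi>) \<Longrightarrow> y \<in> I \<Gamma> \<phi> \<Longrightarrow> app x y \<in> I \<Gamma> \<psi>"
    and dom_Int:
      "single_valued \<Gamma> \<Longrightarrow> single_valued \<Gamma>' \<Longrightarrow> I (\<Gamma> \<inter> \<Gamma>') \<phi> = I \<Gamma> \<phi> \<inter> I \<Gamma>' \<phi>"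
    and mem_supp:
      "single_valued \<Gamma> \<Longrightarrow> x \<in> I \<Gamma> \<phi> \<Longrightarrow> finitely_supported act x \<and> supp act x \<subseteq> Domain \<Gamma>"
    and dom_eqvt: "single_valued \<Gamma> \<Longrightarrow> act_set act p (I \<Gamma> \<phi>) = I (act_env p \<Gamma>) \<phi>"
    and var_eqvt: "act p (var a \<phi>) = var (p \<langle>$\<rangle> a) \<phi>"
    and con_eqvt: "k \<in> dom ctyp \<Longrightarrow> act p (con k) = con k"
    and lam_eqvt:
      "single_valued \<Gamma> \<Longrightarrow> a \<notin> Domain \<Gamma> \<Longrightarrow> x \<in> I (insert (a, \<phi>) \<Gamma>) \<psi> \<Longrightarrow>
        act p (lam a \<phi> x) = lam (p \<langle>$\<rangle> a) \<phi> (act p x)"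
    and app_eqvt:
      "single_valued \<Gamma> \<Longrightarrow> x \<in> I \<Gamma> (\<phi> \<rightarrow>\<^sub>t \<psi>) \<Longrightarrow> y \<in> I \<Gamma> \<phi> \<Longrightarrow>
        act p (app x y) = app (act p x) (act p y)"
    and subst_var:
      "single_valued \<Gamma> \<Longrightarrow> x \<in> I \<Gamma> \<phi> \<Longrightarrow> app (lam a \<phi> (var a \<phi>)) x = x"
    and subst_fresh:
      "single_valued \<Delta> \<Longrightarrow> \<Gamma> \<subseteq> \<Delta> \<Longrightarrow> a \<notin> Domain \<Gamma> \<Longrightarrow>
        z \<in> I (insert (a, \<phi>) \<Gamma>) \<psi> \<Longrightarrow> x \<in> I \<Delta> \<phi> \<Longrightarrow> fresh act a z \<Longrightarrow>
        app (lam a \<phi> z) x = z"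
    and subst_app:
      "single_valued \<Delta> \<Longrightarrow> \<Gamma> \<subseteq> \<Delta> \<Longrightarrow> a \<notin> Domain \<Gamma> \<Longrightarrow>
        z' \<in> I (insert (a, \<phi>) \<Gamma>) (\<psi> \<rightarrow>\<^sub>t \<chi>) \<Longrightarrow> z \<in> I (insert (a, \<phi>) \<Gamma>) \<psi> \<Longrightarrow> x \<in> I \<Delta> \<phi> \<Longrightarrow>
        app (lam a \<phi> (app z' z)) x = app (app (lam a \<phi> z') x) (app (lam a \<phi> z) x)"
    and subst_lam:
      "single_valued \<Delta> \<Longrightarrow> \<Gamma> \<subseteq> \<Delta> \<Longrightarrow> a \<notin> Domain \<Gamma> \<Longrightarrow> c \<notin> Domain \<Delta> \<Longrightarrow> a \<noteq> c \<Longrightarrow>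
        z \<in> I (insert (c, \<chi>) (insert (a, \<phi>) \<Gamma>)) \<psi> \<Longrightarrow> x \<in> I (insert (c, \<chi>) \<Delta>) \<phi> \<Longrightarrow>
        fresh act c x \<Longrightarrow>
        app (lam a \<phi> (lam c \<chi> z)) x = lam c \<chi> (app (lam a \<phi> z) x)"


section \<open>Interpretation\<close>

text \<open>
  On alpha-equivalence classes the clause for abstraction involves the choice of a representative
  whose binder is outside \<open>Domain \<Gamma>\<close>. The graph of the interpretation is therefore
  defined inductively, for all such representatives, and \<open>denote\<close> is its unique value.
\<close>

inductive interp ::
  "(atom \<Rightarrow> 'b ty \<Rightarrow> 'u) \<Rightarrow> ('c \<Rightarrow> 'u) \<Rightarrow> (atom \<Rightarrow> 'b ty \<Rightarrow> 'u \<Rightarrow> 'u) \<Rightarrow> ('u \<Rightarrow> 'u \<Rightarrow> 'u) \<Rightarrow>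
    'b env \<Rightarrow> ('b, 'c) trm \<Rightarrow> 'u \<Rightarrow> bool"
  for var con lam app where
  interp_var: "(a, \<phi>) \<in> \<Gamma> \<Longrightarrow> interp var con lam app \<Gamma> (Var a) (var a \<phi>)"
| interp_con: "interp var con lam app \<Gamma> (Con c) (con c)"
| interp_app: "interp var con lam app \<Gamma> r x \<Longrightarrow> interp var con lam app \<Gamma> s y \<Longrightarrow>
    interp var con lam app \<Gamma> (App r s) (app x y)"
| interp_lam: "a \<notin> Domain \<Gamma> \<Longrightarrow> interp var con lam app (insert (a, \<phi>) \<Gamma>) r x \<Longrightarrow>
    interp var con lam app \<Gamma> (Lam a \<phi> r) (lam a \<phi> x)"

definition denote ::
  "(atom \<Rightarrow> 'b ty \<Rightarrow> 'u) \<Rightarrow> ('c \<Rightarrow> 'u) \<Rightarrow> (atom \<Rightarrow> 'b ty \<Rightarrow> 'u \<Rightarrow> 'u) \<Rightarrow> ('u \<Rightarrow> 'u \<Rightarrow> 'u) \<Rightarrow>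
    'b env \<Rightarrow> ('b, 'c) trm \<Rightarrow> 'u" where
  "denote var con lam app \<Gamma> r = (THE x. interp var con lam app \<Gamma> r x)"

end

theory Submission
  imports Defs
begin

text \<open>
  The graph of the interpretation is single-valued because two representatives \<open>\<lambda>a:\<phi>. r\<close> and
  \<open>\<lambda>b:\<phi>. s\<close> of one abstraction differ by the swap of \<open>a\<close> and \<open>b\<close>. By equivariance the
  two resulting values differ by the same swap, and this swap fixes them, since both atoms lie outside
  \<open>Domain \<Gamma>\<close>, which contains their support. The bound on the support is equivariance of the model
  operations; for an abstraction the bound atom is removed because the value already lives over \<open>\<Gamma>\<close>.
\<close>

section \<open>Finite permutations\<close>

lemma apply_times_simp [simp]: "(p * q) \<langle>$\<rangle> a = p \<langle>$\<rangle> (q \<langle>$\<rangle> a)"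
  by (simp add: apply_times)

lemma apply_inverse_cancel [simp]:
  "inverse p \<langle>$\<rangle> (p \<langle>$\<rangle> a) = a" "p \<langle>$\<rangle> (inverse p \<langle>$\<rangle> a) = a"
  by (simp_all flip: apply_times_simp)

declare apply_inj [simp]

lemma apply_swap: "\<langle>a \<leftrightarrow> b\<rangle> \<langle>$\<rangle> c = (if c = a then b else if c = b then a else c)"
  by simp

text \<open>The usual conjugation formula for transpositions, in a form without inverses. It lets a
  permutation pass through the renaming rule of \<open>alpha\<close>.\<close>

lemma perm_times_swap: "p * \<langle>a \<leftrightarrow> b\<rangle> = \<langle>p \<langle>$\<rangle> a \<leftrightarrow> p \<langle>$\<rangle> b\<rangle> * p"
  by (rule perm_eqI) (auto simp: apply_swap)

text \<open>Composing \<open>p\<close> with the swap of \<open>a\<close> and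
  \<open>p \<langle>$\<rangle> a\<close> makes \<open>a\<close> a fixed point and moves no new atom,
  so the affected set shrinks. Keeping both swapped atoms inside \<open>affected p\<close> matters
  later: if \<open>p\<close> fixes a set pointwise, so do the swap and the shorter
  permutation.\<close>

lemma perm_swap_induct:
  assumes "P 1"
    and "\<And>a b p. a \<in> affected p \<Longrightarrow> b \<in> affected p \<Longrightarrow> P (\<langle>a \<leftrightarrow> b\<rangle> * p) \<Longrightarrow> P p"
  shows "P p"
proof (induction "card (affected p)" arbitrary: p rule: less_induct)
  case less
  show ?case
  proof (cases "p = 1")
    case True
    with assms(1) show ?thesis by simp
  next
    case False
    then obtain a where a: "a \<in> affected p"
      using affected_empty_iff by blast
    define q where "q = \<langle>a \<leftrightarrow> p \<langle>$\<rangle> a\<rangle> * p"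
    have "affected q \<subseteq> affected p - {a}"
      using a by (auto simp: in_affected q_def apply_swap split: if_splits)
    then have "card (affected q) < card (affected p)"
      using a by (metis card_Diff1_less card_mono finite_Diff finite_affected le_less_trans)
    then have "P q" by (rule less)
    with a show ?thesis
      using assms(2)[of a p "p \<langle>$\<rangle> a"] by (simp add: q_def)
  qed
qed

section \<open>Least supports\<close>

lemma infinite_atoms: "infinite (UNIV :: atom set)"
proof -
  have "inj Atom" by (simp add: inj_def)
  then show ?thesis
    using infinite_UNIV_nat finite_imageD infinite_super subset_UNIV by metis
qed

context perm_action
begin

text \<open>A permutation fixing \<open>A \<inter> B\<close> decomposes into swaps of atoms outside
  \<open>A \<inter> B\<close>, so it is enough that each such swap fixes \<open>x\<close>. This is
  reduced to swaps with an atom outside both sets.\<close>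

lemma supports_Int:
  assumes "finite A" "finite B" "supports act A x" "supports act B x"
  shows "supports act (A \<inter> B) x"
proof -
  \<comment> \<open>The atom \<open>a\<close> misses at least one of the two sets and
    \<open>c\<close> misses both, so the swap fixes one supporting set pointwise.\<close>
  have move: "act \<langle>a \<leftrightarrow> c\<rangle> x = x" if "a \<notin> A \<inter> B" "c \<notin> A \<union> B" for a c
  proof (cases "a \<in> A")
    case True
    with that have "\<forall>d\<in>B. \<langle>a \<leftrightarrow> c\<rangle> \<langle>$\<rangle> d = d"
      by (auto simp: apply_swap)
    with assms show ?thesis by (auto simp: supports_def)
  next
    case False
    with that have "\<forall>d\<in>A. \<langle>a \<leftrightarrow> c\<rangle> \<langle>$\<rangle> d = d"
      by (auto simp: apply_swap)
    with assms show ?thesis by (auto simp: supports_def)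
  qed
  have swap: "act \<langle>a \<leftrightarrow> b\<rangle> x = x" if ab: "a \<notin> A \<inter> B" "b \<notin> A \<inter> B" for a b
  proof -
    have "finite (A \<union> B \<union> {a, b})" using assms by simp
    then obtain c where c: "c \<notin> A \<union> B \<union> {a, b}"
      using ex_new_if_finite[OF infinite_atoms] by metis
    show ?thesis
    proof (cases "a = b")
      case True
      then show ?thesis by (simp add: act_one)
    next
      case False
      \<comment> \<open>Conjugation through the new atom \<open>c\<close> rewrites the swap as a
        product of three swaps covered by \<open>move\<close>.\<close>
      with c have "\<langle>a \<leftrightarrow> b\<rangle> = \<langle>a \<leftrightarrow> c\<rangle> * (\<langle>b \<leftrightarrow> c\<rangle> * \<langle>a \<leftrightarrow> c\<rangle>)"
        by (intro perm_eqI) (auto simp: apply_swap)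
      with move[of a c] move[of b c] ab c show ?thesis
        by (simp add: act_times)
    qed
  qed
  have "(\<forall>a\<in>A \<inter> B. p \<langle>$\<rangle> a = a) \<longrightarrow> act p x = x" for p
  proof (induction p rule: perm_swap_induct)
    case 1
    show ?case by (simp add: act_one)
  next
    case (2 a b p)
    show ?case
    proof
      assume fix_p: "\<forall>d\<in>A \<inter> B. p \<langle>$\<rangle> d = d"
      with 2 have ab: "a \<notin> A \<inter> B" "b \<notin> A \<inter> B"
        by (auto simp: in_affected)
      with fix_p have "\<forall>d\<in>A \<inter> B. (\<langle>a \<leftrightarrow> b\<rangle> * p) \<langle>$\<rangle> d = d"
        by (auto simp: apply_swap)
      with 2 have "act (\<langle>a \<leftrightarrow> b\<rangle> * p) x = x" by blast
      then have "act \<langle>a \<leftrightarrow> b\<rangle> (act \<langle>a \<leftrightarrow> b\<rangle> (act p x)) = act \<langle>a \<leftrightarrow> b\<rangle> x"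
        by (simp add: act_times)
      with swap[OF ab] show "act p x = x"
        by (simp add: act_one flip: act_times mult.assoc)
    qed
  qed
  then show ?thesis by (simp add: supports_def)
qed

text \<open>A finite supporting set of minimal cardinality is the least one: its intersection with
  any other finite supporting set still supports \<open>x\<close>, hence cannot be smaller. This
  gives meaning to the \<open>LEAST\<close> in \<open>supp\<close>.\<close>

lemma supp_least:
  assumes "finitely_supported act x"
  shows "finite (supp act x) \<and> supports act (supp act x) x \<and>
    (\<forall>B. finite B \<longrightarrow> supports act B x \<longrightarrow> supp act x \<subseteq> B)"
proof -
  define A where "A = (ARG_MIN card A. finite A \<and> supports act A x)"
  have A: "finite A \<and> supports act A x"
    and card_A: "\<And>B. finite B \<and> supports act B x \<Longrightarrow> card A \<le> card B"
    using assms arg_min_nat_lemma[of "\<lambda>A. finite A \<and> supports act A x" _ card]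
    unfolding finitely_supported_def A_def by blast+
  have least: "A \<subseteq> B" if B: "finite B" "supports act B x" for B
  proof -
    have "card A \<le> card (A \<inter> B)"
      using A B by (intro card_A) (simp add: supports_Int)
    with A have "A \<inter> B = A"
      by (intro card_subset_eq) (auto intro: antisym card_mono)
    then show ?thesis by blast
  qed
  have "supp act x = A"
    unfolding supp_def using A least by (intro Least_equality) auto
  with A least show ?thesis by simp
qed

lemma supp_subset: "finite A \<Longrightarrow> supports act A x \<Longrightarrow> supp act x \<subseteq> A"
  using supp_least by (auto simp: finitely_supported_def)

lemma act_fixes:
  "finitely_supported act x \<Longrightarrow> (\<And>a. a \<in> supp act x \<Longrightarrow> p \<langle>$\<rangle> a = a) \<Longrightarrow> act p x = x"
  using supp_least[of x] by (auto simp: supports_def)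

end

section \<open>Inversion of alpha-equivalence\<close>

lemma raw_perm_one [simp]: "raw_perm 1 r = r"
  by (induction r) auto

lemma raw_perm_times: "raw_perm (p * q) r = raw_perm p (raw_perm q r)"
  by (induction r) auto

text \<open>Only renaming needs an argument: \<open>p\<close> preserves freshness of the new binder
  and turns the swap of the binders into the swap of their images.\<close>

lemma alpha_raw_perm: "alpha r s \<Longrightarrow> alpha (raw_perm p r) (raw_perm p s)"
proof (induction rule: alpha.induct)
  case (alpha_rename b r a \<phi>)
  have "p \<langle>$\<rangle> b \<notin> raw_fa (raw_perm p r)"
    using alpha_rename by (auto simp: raw_fa_perm)
  from alpha.alpha_rename[OF this, of "p \<langle>$\<rangle> a" \<phi>] show ?case
    by (simp add: perm_times_swap flip: raw_perm_times)
qed (simp_all add: alpha_refl alpha_lam alpha_app, erule alpha_sym, erule (1) alpha_trans)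

text \<open>The permutation may still move bound atoms. At an abstraction the moved binder is
  renamed back, and the induction hypothesis is used for \<open>p\<close> followed by that swap,
  which is why \<open>p\<close> is arbitrary in the induction.\<close>

lemma alpha_raw_perm_fixes:
  "(\<And>a. a \<in> raw_fa r \<Longrightarrow> p \<langle>$\<rangle> a = a) \<Longrightarrow> alpha (raw_perm p r) r"
proof (induction r arbitrary: p)
  case (RLam a \<phi> r)
  let ?b = "p \<langle>$\<rangle> a"
  \<comment> \<open>This is the side condition for renaming the binder back to \<open>a\<close>: the
    preimage of \<open>a\<close> under \<open>p\<close> differs from \<open>a\<close>, so if it were
    free in \<open>r\<close> it would have to be fixed.\<close>
  have a: "a \<notin> raw_fa (raw_perm p r)" if "?b \<noteq> a"
  proof
    assume "a \<in> raw_fa (raw_perm p r)"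
    then obtain c where c: "c \<in> raw_fa r" "a = p \<langle>$\<rangle> c"
      by (auto simp: raw_fa_perm)
    with RLam.prems[of c] that show False by (metis DiffI raw_fa.simps(3) singletonD)
  qed
  have "alpha (RLam ?b \<phi> (raw_perm p r)) (RLam a \<phi> (raw_perm (\<langle>?b \<leftrightarrow> a\<rangle> * p) r))"
    using a alpha_rename[of a "raw_perm p r" ?b \<phi>]
    by (cases "?b = a") (auto simp: raw_perm_times alpha_refl)
  moreover have "alpha (raw_perm (\<langle>?b \<leftrightarrow> a\<rangle> * p) r) r"
  proof (rule RLam.IH)
    fix c assume "c \<in> raw_fa r"
    with RLam.prems[of c] show "(\<langle>?b \<leftrightarrow> a\<rangle> * p) \<langle>$\<rangle> c = c"
      by (cases "c = a") (auto simp: apply_swap)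
  qed
  ultimately show ?case
    by (auto intro: alpha_trans alpha_lam)
qed (auto intro: alpha_refl alpha_app)

lemma alpha_raw_perm_cong:
  assumes "\<And>a. a \<in> raw_fa r \<Longrightarrow> p \<langle>$\<rangle> a = q \<langle>$\<rangle> a"
  shows "alpha (raw_perm p r) (raw_perm q r)"
proof -
  have "alpha (raw_perm (inverse q * p) r) r"
    using assms by (intro alpha_raw_perm_fixes) simp
  from alpha_raw_perm[OF this, of q] show ?thesis
    by (simp flip: raw_perm_times mult.assoc)
qed

section \<open>Inversion through the outermost constructor\<close>

text \<open>
  In the case of abstractions an arbitrary permutation is allowed in place of the swap of the two
  binders: this makes the relation visibly symmetric and transitive.
\<close>

inductive alpha_step :: "('b, 'c) raw \<Rightarrow> ('b, 'c) raw \<Rightarrow> bool" where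
  "alpha_step (RVar a) (RVar a)"
| "alpha_step (RCon c) (RCon c)"
| "alpha r r' \<Longrightarrow> alpha s s' \<Longrightarrow> alpha_step (RApp r s) (RApp r' s')"
| "(\<And>c. c \<in> raw_fa r - {a} \<Longrightarrow> p \<langle>$\<rangle> c = c) \<Longrightarrow> p \<langle>$\<rangle> a = b \<Longrightarrow> alpha (raw_perm p r) s \<Longrightarrow>
    alpha_step (RLam a \<phi> r) (RLam b \<phi> s)"

inductive_simps alpha_step_simps [simp]:
  "alpha_step (RVar a) t" "alpha_step (RCon c) t" "alpha_step (RApp r s) t"

inductive_cases alpha_step_LamE: "alpha_step (RLam a \<phi> r) t"

lemma alpha_step_Lam: "alpha r s \<Longrightarrow> alpha_step (RLam a \<phi> r) (RLam a \<phi> s)"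
  by (rule alpha_step.intros(4)[of _ _ 1]) auto

text \<open>Rule inversion on \<open>alpha\<close> is useless because symmetry and transitivity are
  among its rules. Instead \<open>alpha_step\<close>, which fixes the outermost constructor and
  relates subterms by \<open>alpha\<close> itself, is shown to be closed under all of them;
  permutations are inverted for symmetry and composed for transitivity.\<close>

lemma alpha_imp_step: "alpha t u \<Longrightarrow> alpha_step t u"
proof (induction rule: alpha.induct)
  case (alpha_refl r)
  show ?case
    by (cases r) (auto intro: alpha.alpha_refl alpha_step_Lam)
next
  case (alpha_sym t u)
  from alpha_sym.IH show ?case
  proof cases
    case (4 r a p b s \<phi>)
    have s: "raw_fa s = (\<lambda>c. p \<langle>$\<rangle> c) ` raw_fa r"
      using alpha_raw_fa[OF 4(5)] by (simp add: raw_fa_perm)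
    have "inverse p \<langle>$\<rangle> d = d" if d: "d \<in> raw_fa s - {b}" for d
    proof -
      from d s obtain c where c: "c \<in> raw_fa r" "d = p \<langle>$\<rangle> c" by auto
      with d 4(4) have "c \<noteq> a" by auto
      with c 4(3)[of c] show ?thesis by (metis Diff_iff apply_inverse_cancel(1) singletonD)
    qed
    moreover have "inverse p \<langle>$\<rangle> b = a" using 4(4) by auto
    moreover have "alpha (raw_perm (inverse p) s) r"
      using alpha_raw_perm[OF alpha.alpha_sym[OF 4(5)], of "inverse p"]
      by (simp flip: raw_perm_times)
    ultimately show ?thesis
      unfolding 4(1,2) by (rule alpha_step.intros(4))
  qed (auto intro: alpha_step.intros alpha.alpha_sym)
next
  case (alpha_trans t u v)
  from alpha_trans.IH(1) show ?case
  proof cases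
    case (4 r a p b s \<phi>)
    from alpha_trans.IH(2)[unfolded 4(2)] obtain q c w where
      v: "v = RLam c \<phi> w" and q: "\<And>d. d \<in> raw_fa s - {b} \<Longrightarrow> q \<langle>$\<rangle> d = d" "q \<langle>$\<rangle> b = c"
      and w: "alpha (raw_perm q s) w"
      by (elim alpha_step_LamE) blast
    have s: "raw_fa s = (\<lambda>c. p \<langle>$\<rangle> c) ` raw_fa r"
      using alpha_raw_fa[OF 4(5)] by (simp add: raw_fa_perm)
    have "(q * p) \<langle>$\<rangle> d = d" if d: "d \<in> raw_fa r - {a}" for d
    proof -
      have "p \<langle>$\<rangle> d = d" using 4(3) d by blast
      \<comment> \<open>Here \<open>d\<close> is its own image under \<open>p\<close>, and it
        differs from \<open>b\<close> because \<open>p\<close> is injective and already sends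
        \<open>a\<close> to \<open>b\<close>.\<close>
      moreover from this have "d \<in> raw_fa s - {b}"
        using d 4(4) unfolding s by (metis DiffE DiffI apply_inj image_eqI singletonD singletonI)
      ultimately show ?thesis using q(1) by simp
    qed
    moreover have "(q * p) \<langle>$\<rangle> a = c" using 4(4) q(2) by simp
    moreover have "alpha (raw_perm (q * p) r) w"
      using alpha_raw_perm[OF 4(5), of q] w by (auto simp: raw_perm_times intro: alpha.alpha_trans)
    ultimately show ?thesis
      unfolding 4(1) v by (rule alpha_step.intros(4))
  qed (use alpha_trans.IH(2) in \<open>auto intro: alpha.alpha_trans\<close>)
next
  case (alpha_lam r s a \<phi>)
  then show ?case by (auto intro: alpha_step_Lam)
next
  case (alpha_rename b r a \<phi>)
  then show ?case
    by (intro alpha_step.intros(4)[of _ _ "\<langle>a \<leftrightarrow> b\<rangle>"]) (auto simp: apply_swap alpha_refl)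
qed auto

lemma alpha_iff:
  "alpha (RVar a) t \<longleftrightarrow> t = RVar a"
  "alpha (RCon c) t \<longleftrightarrow> t = RCon c"
  "alpha (RApp r s) t \<longleftrightarrow> (\<exists>r' s'. t = RApp r' s' \<and> alpha r r' \<and> alpha s s')"
  using alpha_imp_step[of "RVar a" t] alpha_imp_step[of "RCon c" t] alpha_imp_step[of "RApp r s" t]
  by (auto simp: alpha_refl alpha_app)

lemma alpha_RLam_distinct:
  "\<not> alpha (RLam a \<phi> r) (RVar b)" "\<not> alpha (RLam a \<phi> r) (RCon c)" "\<not> alpha (RLam a \<phi> r) (RApp s t)"
  by (blast dest: alpha_sym[THEN alpha_iff(1)[THEN iffD1]] alpha_sym[THEN alpha_iff(2)[THEN iffD1]]
      alpha_sym[THEN alpha_iff(3)[THEN iffD1]])+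

lemma alpha_RLam_D:
  assumes "alpha (RLam a \<phi> r) (RLam b \<psi> s)"
  shows "\<phi> = \<psi> \<and> alpha (raw_perm \<langle>a \<leftrightarrow> b\<rangle> r) s"
proof -
  from alpha_imp_step[OF assms] obtain p where
    p: "\<phi> = \<psi>" "\<And>c. c \<in> raw_fa r - {a} \<Longrightarrow> p \<langle>$\<rangle> c = c" "p \<langle>$\<rangle> a = b" "alpha (raw_perm p r) s"
    by (elim alpha_step_LamE) auto
  have "\<langle>a \<leftrightarrow> b\<rangle> \<langle>$\<rangle> c = p \<langle>$\<rangle> c" if "c \<in> raw_fa r" for c
  proof (cases "c = a")
    case False
    with p(2)[of c] that have pc: "p \<langle>$\<rangle> c = c" by blast
    \<comment> \<open>Injectivity of \<open>p\<close> rules out \<open>c = b\<close>, so the swap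
      and \<open>p\<close> agree on all free atoms of \<open>r\<close>, which is all that matters up
      to \<open>alpha\<close>.\<close>
    with False p(3) have "c \<noteq> b" by auto
    with pc False show ?thesis by simp
  qed (use p(3) in simp)
  then have "alpha (raw_perm \<langle>a \<leftrightarrow> b\<rangle> r) (raw_perm p r)" by (rule alpha_raw_perm_cong)
  with p show ?thesis by (auto intro: alpha_trans)
qed

section \<open>Permutations, free atoms and constructors on alpha-equivalence classes\<close>

lift_definition trm_perm :: "atom perm \<Rightarrow> ('b, 'c) trm \<Rightarrow> ('b, 'c) trm" is raw_perm
  by (rule alpha_raw_perm)

lemma trm_perm_simps [simp]:
  "trm_perm p (Var a) = Var (p \<langle>$\<rangle> a)"
  "trm_perm p (Con c) = Con c"
  "trm_perm p (App r s) = App (trm_perm p r) (trm_perm p s)"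
  "trm_perm p (Lam a \<phi> r) = Lam (p \<langle>$\<rangle> a) \<phi> (trm_perm p r)"
  by (transfer; simp add: alpha_refl)+

lemma trm_perm_one [simp]: "trm_perm 1 r = r"
  by transfer (simp add: alpha_refl)

lemma trm_perm_times: "trm_perm (p * q) r = trm_perm p (trm_perm q r)"
  by transfer (simp add: raw_perm_times alpha_refl)

lemma fa_simps [simp]:
  "fa (Var a) = {a}" "fa (Con c) = {}" "fa (App r s) = fa r \<union> fa s" "fa (Lam a \<phi> r) = fa r - {a}"
  by (transfer; simp)+

lemma trm_inject [simp]:
  "Var a = Var b \<longleftrightarrow> a = b"
  "Con c = Con d \<longleftrightarrow> c = d"
  "App r s = App r' s' \<longleftrightarrow> r = r' \<and> s = s'"
  by (transfer; auto simp: alpha_iff)+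

lemma trm_distinct [simp]:
  "Var a \<noteq> Con c" "Con c \<noteq> Var a" "Var a \<noteq> App r s" "App r s \<noteq> Var a"
  "Var a \<noteq> Lam b \<phi> r" "Lam b \<phi> r \<noteq> Var a" "Con c \<noteq> App r s" "App r s \<noteq> Con c"
  "Con c \<noteq> Lam b \<phi> r" "Lam b \<phi> r \<noteq> Con c" "App r s \<noteq> Lam b \<phi> t" "Lam b \<phi> t \<noteq> App r s"
  by (transfer; simp add: alpha_iff alpha_RLam_distinct)+

lemma Lam_eq_D: "Lam a \<phi> r = Lam b \<psi> s \<Longrightarrow> \<phi> = \<psi> \<and> trm_perm \<langle>a \<leftrightarrow> b\<rangle> r = s"
  by (induct r rule: trm.abs_induct, induct s rule: trm.abs_induct)
    (auto simp: Lam.abs_eq trm_perm.abs_eq trm.abs_eq_iff dest: alpha_RLam_D)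

section \<open>Interpretations\<close>

\<comment> \<open>Abstractions are left out: \<open>Lam\<close> is not injective, so inverting its
  rule yields another representative, to be compared by \<open>Lam_eq_D\<close>.\<close>
inductive_simps interp_simps:
  "interp var con lam app \<Gamma> (Var a) y"
  "interp var con lam app \<Gamma> (Con c) y"
  "interp var con lam app \<Gamma> (App r s) y"

section \<open>Permutations acting on type environments\<close>

lemma act_env_one [simp]: "act_env 1 \<Gamma> = \<Gamma>"
  by (force simp: act_env_def)

lemma act_env_times: "act_env (p * q) \<Gamma> = act_env p (act_env q \<Gamma>)"
  by (force simp: act_env_def)

lemma act_env_insert [simp]: "act_env p (insert (a, \<phi>) \<Gamma>) = insert (p \<langle>$\<rangle> a, \<phi>) (act_env p \<Gamma>)"
  by (simp add: act_env_def)

lemma Domain_act_env: "Domain (act_env p \<Gamma>) = apply p ` Domain \<Gamma>"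
  by (force simp: act_env_def)

lemma single_valued_act_env: "single_valued \<Gamma> \<Longrightarrow> single_valued (act_env p \<Gamma>)"
  by (auto simp: single_valued_def act_env_def)

lemma act_env_fixes: "(\<And>a. a \<in> Domain \<Gamma> \<Longrightarrow> p \<langle>$\<rangle> a = a) \<Longrightarrow> act_env p \<Gamma> = \<Gamma>"
  by (force simp: act_env_def)

lemma single_valued_insert: "single_valued \<Gamma> \<Longrightarrow> a \<notin> Domain \<Gamma> \<Longrightarrow> single_valued (insert (a, \<phi>) \<Gamma>)"
  by (auto simp: single_valued_def)

lemma typing_single_valued: "typing ctyp \<Gamma> r \<phi> \<Longrightarrow> single_valued \<Gamma>"
  by (induction rule: typing.induct) (auto simp: single_valued_def)

context nominal_model
begin

text \<open>
  Equivariance of the interpretation is carried through the induction together with uniqueness: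
  changing the representative of an abstraction permutes the interpretation of its body.
\<close>

lemma interp_unique:
  assumes "typing ctyp \<Gamma> r \<phi>"
  shows "\<exists>x. x \<in> I \<Gamma> \<phi> \<and> supp act x \<subseteq> fa r \<and>
    (\<forall>p y. interp var con lam app (act_env p \<Gamma>) (trm_perm p r) y \<longleftrightarrow> y = act p x)"
  using assms
proof (induction rule: typing.induct)
  case (typing_var \<Gamma> a \<phi>)
  let ?\<Gamma> = "insert (a, \<phi>) \<Gamma>"
  have sv: "single_valued ?\<Gamma>" using typing_var by (rule single_valued_insert)
  have "supp act (var a \<phi>) \<subseteq> fa (Var a)"
    unfolding fa_simps
    by (rule supp_subset) (auto simp: supports_def var_eqvt)
  \<comment> \<open>The rule for variables allows any type that the environment assigns to the atom;
    single-valuedness leaves only \<phi>.\<close>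
  moreover have "interp var con lam app (act_env p ?\<Gamma>) (trm_perm p (Var a)) y \<longleftrightarrow>
      y = act p (var a \<phi>)" for p y
    using single_valued_act_env[OF sv, of p]
    by (auto simp: var_eqvt interp_simps dest: single_valuedD)
  ultimately show ?case
    using var_mem[OF sv, of a \<phi>] by blast
next
  case (typing_con \<Gamma> c \<phi>)
  then have c: "act p (con c) = con c" for p
    using con_eqvt by blast
  have "supp act (con c) \<subseteq> fa (Con c)"
    unfolding fa_simps
    by (rule supp_subset) (auto simp: supports_def c)
  moreover have "interp var con lam app (act_env p \<Gamma>) (trm_perm p (Con c)) y \<longleftrightarrow>
      y = act p (con c)" for p y
    by (auto simp: c interp_simps)
  ultimately show ?case
    using con_mem[OF typing_con] by blast
next
  case (typing_app \<Gamma> r \<phi> \<psi> s)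
  have sv: "single_valued \<Gamma>" using typing_app.hyps by (blast intro: typing_single_valued)
  from typing_app.IH obtain x y where
    x: "x \<in> I \<Gamma> (\<phi> \<rightarrow>\<^sub>t \<psi>)" "supp act x \<subseteq> fa r"
      "\<And>p z. interp var con lam app (act_env p \<Gamma>) (trm_perm p r) z \<longleftrightarrow> z = act p x"
    and y: "y \<in> I \<Gamma> \<phi>" "supp act y \<subseteq> fa s"
      "\<And>p z. interp var con lam app (act_env p \<Gamma>) (trm_perm p s) z \<longleftrightarrow> z = act p y"
    by blast
  have fs: "finitely_supported act x" "finitely_supported act y"
    using mem_supp[OF sv] x y by blast+
  note eqvt = app_eqvt[OF sv x(1) y(1)]
  have "supp act (app x y) \<subseteq> supp act x \<union> supp act y"
    using fs act_fixes[OF fs(1)] act_fixes[OF fs(2)] supp_least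
    by (intro supp_subset) (auto simp: supports_def eqvt)
  with x y have "supp act (app x y) \<subseteq> fa (App r s)" by auto
  moreover have "interp var con lam app (act_env p \<Gamma>) (trm_perm p (App r s)) z \<longleftrightarrow>
      z = act p (app x y)" for p z
    by (auto simp: eqvt x(3) y(3) interp_simps)
  ultimately show ?case
    using app_mem[OF sv x(1) y(1)] by blast
next
  case (typing_lam a \<Gamma> \<phi> r \<psi>)
  have sv': "single_valued (insert (a, \<phi>) \<Gamma>)"
    using typing_lam.hyps by (blast intro: typing_single_valued)
  then have sv: "single_valued \<Gamma>" by (rule single_valued_subset[rotated]) auto
  from typing_lam.IH obtain x where
    x: "x \<in> I (insert (a, \<phi>) \<Gamma>) \<psi>" "supp act x \<subseteq> fa r"
      "\<And>p z. interp var con lam app (act_env p (insert (a, \<phi>) \<Gamma>)) (trm_perm p r) z \<longleftrightarrow> z = act p x"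
    by blast
  have fs: "finitely_supported act x"
    using mem_supp[OF sv'] x by blast
  note eqvt = lam_eqvt[OF sv \<open>a \<notin> Domain \<Gamma>\<close> x(1)]
  have mem: "lam a \<phi> x \<in> I \<Gamma> (\<phi> \<rightarrow>\<^sub>t \<psi>)"
    using sv \<open>a \<notin> Domain \<Gamma>\<close> x(1) by (rule lam_mem)
  have "supp act (lam a \<phi> x) \<subseteq> insert a (supp act x)"
    using fs act_fixes[OF fs] supp_least
    by (intro supp_subset) (auto simp: supports_def eqvt)
  moreover have "a \<notin> supp act (lam a \<phi> x)"
    using mem_supp[OF sv mem] typing_lam.hyps by blast
  ultimately have "supp act (lam a \<phi> x) \<subseteq> fa (Lam a \<phi> r)"
    using x(2) by auto
  moreover have "interp var con lam app (act_env p \<Gamma>) (trm_perm p (Lam a \<phi> r)) z \<longleftrightarrow>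
      z = act p (lam a \<phi> x)" for p z
  proof
    assume "z = act p (lam a \<phi> x)"
    moreover have "interp var con lam app (act_env p \<Gamma>) (Lam (p \<langle>$\<rangle> a) \<phi> (trm_perm p r))
        (lam (p \<langle>$\<rangle> a) \<phi> (act p x))"
      using x(3)[of p "act p x"] typing_lam.hyps
      by (intro interp_lam) (auto simp: Domain_act_env)
    ultimately show "interp var con lam app (act_env p \<Gamma>) (trm_perm p (Lam a \<phi> r)) z"
      by (simp add: eqvt)
  next
    let ?\<Delta> = "act_env p \<Gamma>"
    assume "interp var con lam app ?\<Delta> (trm_perm p (Lam a \<phi> r)) z"
    then obtain b s y where eq: "Lam (p \<langle>$\<rangle> a) \<phi> (trm_perm p r) = Lam b \<phi> s"
      and b: "b \<notin> Domain ?\<Delta>"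
      and y: "interp var con lam app (insert (b, \<phi>) ?\<Delta>) s y" and z: "z = lam b \<phi> y"
      by cases (auto dest: Lam_eq_D)
    \<comment> \<open>The swap of the two binders fixes \<open>?\<Delta>\<close>, so
      \<open>\<sigma> * p\<close> carries \<open>r\<close> and its extended environment to those of
      the other representative. The induction hypothesis is therefore needed at
      \<open>\<sigma> * p\<close>, not only at \<open>p\<close>.\<close>
    define \<sigma> where "\<sigma> = \<langle>p \<langle>$\<rangle> a \<leftrightarrow> b\<rangle>"
    have pa: "p \<langle>$\<rangle> a \<notin> Domain ?\<Delta>"
      using typing_lam.hyps by (auto simp: Domain_act_env)
    have \<sigma>_fix: "\<sigma> \<langle>$\<rangle> c = c" if "c \<in> Domain ?\<Delta>" for c
      using that b pa by (auto simp: \<sigma>_def apply_swap)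
    have "trm_perm (\<sigma> * p) r = s"
      using Lam_eq_D[OF eq] by (simp add: \<sigma>_def trm_perm_times)
    moreover have "act_env (\<sigma> * p) (insert (a, \<phi>) \<Gamma>) = insert (b, \<phi>) ?\<Delta>"
      using act_env_fixes[of ?\<Delta> \<sigma>, OF \<sigma>_fix] by (simp add: \<sigma>_def act_env_times)
    ultimately have "y = act (\<sigma> * p) x"
      using y x(3)[of "\<sigma> * p" y] by simp
    then have "z = act (\<sigma> * p) (lam a \<phi> x)"
      by (simp add: z eqvt \<sigma>_def)
    \<comment> \<open>By \<open>dom_eqvt\<close> this value lives over \<open>?\<Delta>\<close>, so
      its support avoids both swapped atoms.\<close>
    moreover have "act \<sigma> (act p (lam a \<phi> x)) = act p (lam a \<phi> x)"
    proof -
      have "act p (lam a \<phi> x) \<in> I ?\<Delta> (\<phi> \<rightarrow>\<^sub>t \<psi>)"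
        using mem dom_eqvt[OF sv] by blast
      from mem_supp[OF single_valued_act_env[OF sv] this] show ?thesis
        using \<sigma>_fix by (intro act_fixes) blast+
    qed
    ultimately show "z = act p (lam a \<phi> x)" by (simp add: act_times)
  qed
  ultimately show ?case
    using mem by blast
qed

lemma denote_mem_supp:
  assumes "typing ctyp \<Gamma> r \<phi>"
  shows "denote var con lam app \<Gamma> r \<in> I \<Gamma> \<phi> \<and> supp act (denote var con lam app \<Gamma> r) \<subseteq> fa r"
proof -
  from interp_unique[OF assms] obtain x where x: "x \<in> I \<Gamma> \<phi>" "supp act x \<subseteq> fa r"
    and unique: "\<And>p y. interp var con lam app (act_env p \<Gamma>) (trm_perm p r) y \<longleftrightarrow> y = act p x"
    by blast
  \<comment> \<open>At the identity permutation the equivalence says that \<open>x\<close> is the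
    only value related to \<open>r\<close> over \<Gamma>, as the definite description in
    \<open>denote\<close> requires.\<close>
  from unique[of 1] have "denote var con lam app \<Gamma> r = x"
    by (simp add: denote_def act_one)
  with x show ?thesis by simp
qed

end

theorem theorem3p4:
  fixes act :: "atom perm \<Rightarrow> 'u \<Rightarrow> 'u"
    and ctyp :: "'c \<rightharpoonup> 'b ty"
    and I :: "'b env \<Rightarrow> 'b ty \<Rightarrow> 'u set"
    and \<Gamma> :: "'b env" and r :: "('b, 'c) trm" and \<phi> :: "'b ty"
  assumes "nominal_model act ctyp I var con lam app"
    and "typing ctyp \<Gamma> r \<phi>"
  shows "denote var con lam app \<Gamma> r \<in> I \<Gamma> \<phi> \<and>
    supp act (denote var con lam app \<Gamma> r) \<subseteq> fa r"
  using assms by (rule nominal_model.denote_mem_supp)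

end
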